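(* For $t\in[0,\pi]$ let $\alpha(t)=\cos t\,i+\sin t\,j\in\mathrm{Im}\,\mathbb{H}$ and define $\theta_{8,t}:\mathcal{S}^7\to S^3$ by $\theta_{8,t}(x,w)=\frac{w}{|w|}e^{\pi x\alpha(t)\bar x}\frac{\bar w}{|w|}$ for $w\ne0$ and $\theta_{8,t}(x,w)=-1$ for $w=0$; put $\theta_8=\theta_{8,0}$. Then $\hat\theta_{8,t}\circ\hat\theta_8=\widehat{\theta_8\theta_{8,t}}$ for all $t$, and $t\mapsto\hat\theta_{8,t}\circ\hat\theta_8$, $t\in[0,\pi]$, is an isotopy of diffeomorphisms of $\mathcal{S}^7$ from $\hat\theta_8^{\,2}=\hat\theta_8\circ\hat\theta_8$ (at $t=0$) to the identity (at $t=\pi$).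
   Context: $\mathbb{H}$ denotes the quaternions with standard units $i,j,k$, and $S^3$ the group of unit quaternions. $\mathcal{S}^7=\{(x,w)\in\mathbb{H}^2:|x|^2+|w|^2=1\}$ with the $S^3$-action $q\cdot(x,w)=(qx,qw\bar q)$. For a map $\theta:\mathcal{S}^7\to S^3$ satisfying $\theta(q\cdot z)=q\theta(z)q^{-1}$, one defines $\hat\theta:\mathcal{S}^7\to\mathcal{S}^7$ by $\hat\theta(z)=\theta(z)\cdot z$. Products such as $\theta_8\theta_{8,t}$ are pointwise products in $S^3$. *)

theory Defs
  imports "HOL-Analysis.Analysis"
begin

section \<open>The quaternions\<close>

datatype quat = Quat (qRe: real) (qIm1: real) (qIm2: real) (qIm3: real)

lemma quat_eq_iff:
  "p = q \<longleftrightarrow> qRe p = qRe q \<and> qIm1 p = qIm1 q \<and> qIm2 p = qIm2 q \<and> qIm3 p = qIm3 q"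
  by (cases p; cases q) simp

instantiation quat :: ring_1
begin

definition zero_quat :: quat where "0 = Quat 0 0 0 0"

definition one_quat :: quat where "1 = Quat 1 0 0 0"

definition plus_quat :: "quat \<Rightarrow> quat \<Rightarrow> quat" where
  "p + q = Quat (qRe p + qRe q) (qIm1 p + qIm1 q) (qIm2 p + qIm2 q) (qIm3 p + qIm3 q)"

definition minus_quat :: "quat \<Rightarrow> quat \<Rightarrow> quat" where
  "p - q = Quat (qRe p - qRe q) (qIm1 p - qIm1 q) (qIm2 p - qIm2 q) (qIm3 p - qIm3 q)"

definition uminus_quat :: "quat \<Rightarrow> quat" where
  "- q = Quat (- qRe q) (- qIm1 q) (- qIm2 q) (- qIm3 q)"

definition times_quat :: "quat \<Rightarrow> quat \<Rightarrow> quat" where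
  "p * q = Quat
    (qRe p * qRe q - qIm1 p * qIm1 q - qIm2 p * qIm2 q - qIm3 p * qIm3 q)
    (qRe p * qIm1 q + qIm1 p * qRe q + qIm2 p * qIm3 q - qIm3 p * qIm2 q)
    (qRe p * qIm2 q - qIm1 p * qIm3 q + qIm2 p * qRe q + qIm3 p * qIm1 q)
    (qRe p * qIm3 q + qIm1 p * qIm2 q - qIm2 p * qIm1 q + qIm3 p * qRe q)"

lemmas quat_ring_defs =
  zero_quat_def one_quat_def plus_quat_def minus_quat_def uminus_quat_def times_quat_def

instance
proof
  fix p q r :: quat
  show "p * q * r = p * (q * r)"
    by (simp add: times_quat_def algebra_simps)
  show "(p + q) * r = p * r + q * r" "p * (q + r) = p * q + p * r"
    by (simp_all add: times_quat_def plus_quat_def algebra_simps)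
qed (simp_all add: quat_ring_defs)

end

definition quat_i :: quat where "quat_i = Quat 0 1 0 0"

definition quat_j :: quat where "quat_j = Quat 0 0 1 0"

definition quat_k :: quat where "quat_k = Quat 0 0 0 1"

definition qcnj :: "quat \<Rightarrow> quat" where
  "qcnj q = Quat (qRe q) (- qIm1 q) (- qIm2 q) (- qIm3 q)"

lemma quat_units:
  "quat_i * quat_i = -1" "quat_j * quat_j = -1" "quat_k * quat_k = -1"
  "quat_i * quat_j = quat_k" "quat_j * quat_k = quat_i" "quat_k * quat_i = quat_j"
  by (simp_all add: quat_i_def quat_j_def quat_k_def quat_ring_defs)

instantiation quat :: real_algebra_1
begin

definition scaleR_quat :: "real \<Rightarrow> quat \<Rightarrow> quat" where
  "r *\<^sub>R q = Quat (r * qRe q) (r * qIm1 q) (r * qIm2 q) (r * qIm3 q)"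

instance
  by standard (simp_all add: scaleR_quat_def quat_ring_defs quat_eq_iff algebra_simps)

end

instantiation quat :: real_inner
begin

definition inner_quat :: "quat \<Rightarrow> quat \<Rightarrow> real" where
  "inner p q = qRe p * qRe q + qIm1 p * qIm1 q + qIm2 p * qIm2 q + qIm3 p * qIm3 q"

definition norm_quat :: "quat \<Rightarrow> real" where
  "norm (q :: quat) = sqrt (inner q q)"

definition sgn_quat :: "quat \<Rightarrow> quat" where
  "sgn (q :: quat) = q /\<^sub>R norm q"

definition dist_quat :: "quat \<Rightarrow> quat \<Rightarrow> real" where
  "dist p q = norm (p - q)" for p q :: quat

definition uniformity_quat :: "(quat \<times> quat) filter" where
  "uniformity = (INF e\<in>{0<..}. principal {(p, q :: quat). dist p q < e})"

definition open_quat :: "quat set \<Rightarrow> bool" where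
  "open U \<longleftrightarrow> (\<forall>p\<in>U. eventually (\<lambda>(p', q). p' = p \<longrightarrow> q \<in> U) uniformity)"
  for U :: "quat set"

instance
proof
  fix p q s :: quat and r :: real
  show "inner p q = inner q p"
    by (simp add: inner_quat_def algebra_simps)
  show "inner (p + q) s = inner p s + inner q s"
    by (simp add: inner_quat_def plus_quat_def algebra_simps)
  show "inner (r *\<^sub>R p) q = r * inner p q"
    by (simp add: inner_quat_def scaleR_quat_def algebra_simps)
  show "0 \<le> inner p p"
    by (simp add: inner_quat_def)
  have sq: "a * a + b * b + c * c + d * d = 0 \<longleftrightarrow> a = 0 \<and> b = 0 \<and> c = 0 \<and> d = 0"
    for a b c d :: real
    by (simp add: add_nonneg_eq_0_iff)
  show "inner p p = 0 \<longleftrightarrow> p = 0"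
    by (simp add: inner_quat_def zero_quat_def quat_eq_iff sq)
qed (rule norm_quat_def sgn_quat_def dist_quat_def uniformity_quat_def open_quat_def)+

end

instantiation quat :: euclidean_space
begin

definition Basis_quat :: "quat set" where
  "Basis = {1, quat_i, quat_j, quat_k}"

instance
proof
  show "inner u v = (if u = v then 1 else 0)" if "u \<in> Basis" "v \<in> Basis" for u v :: quat
    using that unfolding Basis_quat_def
    by (elim insertE emptyE)
      (simp_all add: inner_quat_def one_quat_def quat_i_def quat_j_def quat_k_def)
  show "(\<forall>u\<in>Basis. inner p u = 0) \<longleftrightarrow> p = 0" for p :: quat
    by (cases p)
      (simp add: Basis_quat_def inner_quat_def one_quat_def zero_quat_def
        quat_i_def quat_j_def quat_k_def)
qed (simp_all add: Basis_quat_def)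

end

instantiation quat :: real_normed_div_algebra
begin

definition inverse_quat :: "quat \<Rightarrow> quat" where
  "inverse q = qcnj q /\<^sub>R (norm q)\<^sup>2"

definition divide_quat :: "quat \<Rightarrow> quat \<Rightarrow> quat" where
  "p div q = p * inverse q" for p q :: quat

lemma quat_mult_qcnj: "q * qcnj q = (norm q)\<^sup>2 *\<^sub>R 1" "qcnj q * q = (norm q)\<^sup>2 *\<^sub>R 1"
  by (simp_all add: power2_norm_eq_inner inner_quat_def qcnj_def scaleR_quat_def times_quat_def
      one_quat_def algebra_simps)

instance
proof
  fix p q :: quat
  show "q \<noteq> 0 \<Longrightarrow> inverse q * q = 1" "q \<noteq> 0 \<Longrightarrow> q * inverse q = 1"
    by (simp_all add: inverse_quat_def quat_mult_qcnj)
  show "p div q = p * inverse q"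
    by (rule divide_quat_def)
  show "inverse (0 :: quat) = 0"
    by (simp add: inverse_quat_def)
  have "inner (p * q) (p * q) = inner p p * inner q q"
    unfolding inner_quat_def times_quat_def quat.sel by algebra
  then show "norm (p * q) = norm p * norm q"
    by (simp add: norm_quat_def real_sqrt_mult)
qed

end


section \<open>Smooth maps, diffeomorphisms and isotopies\<close>

text \<open>\<open>Ck_on k f U\<close> is meant for open \<open>U\<close>: all iterated directional derivatives of \<open>f\<close> of order
  less than \<open>k\<close> are differentiable, and those of order \<open>k\<close> are continuous on \<open>U\<close>.\<close>

primrec Ck_on ::
  "nat \<Rightarrow> ('a::euclidean_space \<Rightarrow> 'b::real_normed_vector) \<Rightarrow> 'a set \<Rightarrow> bool" where
  "Ck_on 0 f U \<longleftrightarrow> continuous_on U f"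
| "Ck_on (Suc k) f U \<longleftrightarrow> (\<forall>x\<in>U. f differentiable (at x)) \<and>
     (\<forall>v. Ck_on k (\<lambda>x. frechet_derivative f (at x) v) U)"

text \<open>A map on an arbitrary subset \<open>A\<close> of a Euclidean space is smooth if it is, locally around
  each point of \<open>A\<close>, the restriction of a \<open>C\<^sup>\<infinity>\<close> map on an open set. For embedded
  submanifolds, with or without boundary, this is the usual notion.\<close>

definition smooth_map_on ::
  "'a::euclidean_space set \<Rightarrow> ('a \<Rightarrow> 'b::real_normed_vector) \<Rightarrow> bool" where
  "smooth_map_on A f \<longleftrightarrow>
     (\<forall>x\<in>A. \<exists>U g. open U \<and> x \<in> U \<and> (\<forall>k. Ck_on k g U) \<and> (\<forall>y\<in>U \<inter> A. g y = f y))"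

definition diffeomorphism_on :: "'a::euclidean_space set \<Rightarrow> ('a \<Rightarrow> 'a) \<Rightarrow> bool" where
  "diffeomorphism_on M f \<longleftrightarrow>
     bij_betw f M M \<and> smooth_map_on M f \<and> smooth_map_on M (inv_into M f)"

definition isotopy_of_diffeos ::
  "real \<Rightarrow> real \<Rightarrow> 'a::euclidean_space set \<Rightarrow> (real \<Rightarrow> 'a \<Rightarrow> 'a) \<Rightarrow> ('a \<Rightarrow> 'a) \<Rightarrow> ('a \<Rightarrow> 'a) \<Rightarrow> bool"
where
  "isotopy_of_diffeos a b M F f g \<longleftrightarrow>
     smooth_map_on ({a..b} \<times> M) (\<lambda>(t, z). F t z) \<and>
     (\<forall>t\<in>{a..b}. diffeomorphism_on M (F t)) \<and>
     (\<forall>z\<in>M. F a z = f z) \<and> (\<forall>z\<in>M. F b z = g z)"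


section \<open>The action of the unit quaternions on the seven-sphere\<close>

definition S3 :: "quat set" where
  "S3 = {q. norm q = 1}"

definition S7 :: "(quat \<times> quat) set" where
  "S7 = {(x, w). (norm x)\<^sup>2 + (norm w)\<^sup>2 = 1}"

definition act :: "quat \<Rightarrow> quat \<times> quat \<Rightarrow> quat \<times> quat" where
  "act q = (\<lambda>(x, w). (q * x, q * w * qcnj q))"

definition equivariant_map :: "(quat \<times> quat \<Rightarrow> quat) \<Rightarrow> bool" where
  "equivariant_map \<theta> \<longleftrightarrow>
     (\<forall>z\<in>S7. \<theta> z \<in> S3) \<and> (\<forall>q\<in>S3. \<forall>z\<in>S7. \<theta> (act q z) = q * \<theta> z * inverse q)"

definition hat :: "(quat \<times> quat \<Rightarrow> quat) \<Rightarrow> quat \<times> quat \<Rightarrow> quat \<times> quat" where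
  "hat \<theta> z = act (\<theta> z) z"

definition alpha :: "real \<Rightarrow> quat" where
  "alpha t = cos t *\<^sub>R quat_i + sin t *\<^sub>R quat_j"

definition theta8t :: "real \<Rightarrow> quat \<times> quat \<Rightarrow> quat" where
  "theta8t t = (\<lambda>(x, w).
     if w \<noteq> 0
     then (w /\<^sub>R norm w) * exp (pi *\<^sub>R (x * alpha t * qcnj x)) * (qcnj w /\<^sub>R norm w)
     else - 1)"

definition theta8 :: "quat \<times> quat \<Rightarrow> quat" where
  "theta8 = theta8t 0"

end

theory Submission
  imports Defs
begin

text \<open>For unit \<open>u\<close> with \<open>u\<^sup>2 = -1\<close> one has \<open>exp (r u) = cos r + sin r u\<close>. Hence on the sphere
  \<open>\<theta>\<^sub>8\<^sub>,\<^sub>t(x,w) = cos (\<pi> |x|\<^sup>2) + c w x \<alpha>(t) x\<^sup>* w\<^sup>*\<close>, where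
  \<open>c = sin (\<pi> |x|\<^sup>2) / (|x|\<^sup>2 |w|\<^sup>2)\<close>. Since \<open>|x|\<^sup>2 + |w|\<^sup>2 = 1\<close>, partial fractions give
  \<open>c = sin (\<pi> |x|\<^sup>2) / |x|\<^sup>2 + sin (\<pi> |w|\<^sup>2) / |w|\<^sup>2\<close>, and \<open>sin r / r\<close> is an entire power
  series; so the right-hand side is smooth in \<open>(t,x,w)\<close> on the whole ambient space, and its
  equivariance is visible. Equivariance of \<open>\<theta>\<close> gives \<open>\<theta>(\<theta>(z)\<cdot>z) = \<theta>(z)\<close>,
  so \<open>hat \<theta>\<close> is inverted by \<open>hat\<close> of the pointwise inverse of \<open>\<theta>\<close>.\<close>

section \<open>Calculus of \<open>C\<^sup>k\<close> maps\<close>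

text \<open>Openness makes the derivative at a point of \<open>U\<close> depend only on values
  inside \<open>U\<close>, so agreement passes to the directional derivatives and the induction
  runs.\<close>

lemma Ck_on_cong:
  assumes "open U" "\<And>x. x \<in> U \<Longrightarrow> f x = g x" "Ck_on k f U"
  shows "Ck_on k g U"
  using assms(2,3)
proof (induction k arbitrary: f g)
  case 0
  then show ?case
    using continuous_on_cong[of U U f g] by simp
next
  case (Suc k)
  have g: "(g has_derivative frechet_derivative f (at x)) (at x)" if "x \<in> U" for x
    by (rule has_derivative_transform_within_open[where f = f, OF _ \<open>open U\<close> that])
      (use Suc.prems that in \<open>auto simp flip: frechet_derivative_works\<close>)
  have "Ck_on k (\<lambda>x. frechet_derivative g (at x) v) U" for v
    by (rule Suc.IH[of "\<lambda>x. frechet_derivative f (at x) v"])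
      (use Suc.prems in \<open>simp_all add: frechet_derivative_at[OF g, symmetric]\<close>)
  with g show ?case
    by (auto simp: differentiable_def)
qed

text \<open>Uniqueness of derivatives allows an explicit \<open>f'\<close> in place of
  \<open>frechet_derivative\<close>; the closure rules below are proved this way.\<close>

lemma Ck_on_SucI:
  assumes "open U" "\<And>x. x \<in> U \<Longrightarrow> (f has_derivative f' x) (at x)"
    and "\<And>v. Ck_on k (\<lambda>x. f' x v) U"
  shows "Ck_on (Suc k) f U"
proof -
  have "Ck_on k (\<lambda>x. frechet_derivative f (at x) v) U" for v
    by (rule Ck_on_cong[OF assms(1) _ assms(3)[of v]])
      (simp add: frechet_derivative_at[OF assms(2), symmetric])
  then show ?thesis
    using assms(2) by (auto simp: differentiable_def)
qed

lemma Ck_on_SucD: "Ck_on (Suc k) f U \<Longrightarrow> Ck_on k f U"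
proof (induction k arbitrary: f)
  case 0
  then show ?case
    by (auto intro!: continuous_at_imp_continuous_on differentiable_imp_continuous_within)
qed auto

lemma Ck_on_Suc_has_derivative:
  "Ck_on (Suc k) f U \<Longrightarrow> x \<in> U \<Longrightarrow> (f has_derivative frechet_derivative f (at x)) (at x)"
  by (simp add: frechet_derivative_works)

lemma Ck_on_const: "open U \<Longrightarrow> Ck_on k (\<lambda>x. c) U"
proof (induction k arbitrary: c)
  case (Suc k)
  then show ?case
    by (intro Ck_on_SucI[where f' = "\<lambda>x v. 0"]) auto
qed simp

lemma Ck_on_ident: "open U \<Longrightarrow> Ck_on k (\<lambda>x. x) U"
  by (cases k) (auto intro!: Ck_on_SucI[where f' = "\<lambda>x v. v"] Ck_on_const)

lemma Ck_on_bounded_linear: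
  assumes "bounded_linear L" "open U" "Ck_on k f U"
  shows "Ck_on k (\<lambda>x. L (f x)) U"
  using assms(3)
proof (induction k arbitrary: f)
  case 0
  then show ?case
    using assms(1) by (simp add: bounded_linear.continuous_on)
next
  case (Suc k)
  show ?case
    by (rule Ck_on_SucI[OF \<open>open U\<close> bounded_linear.has_derivative[OF assms(1)
            Ck_on_Suc_has_derivative[OF Suc.prems]] Suc.IH])
      (use Suc.prems in auto)
qed

lemma Ck_on_add:
  assumes "open U" "Ck_on k f U" "Ck_on k g U"
  shows "Ck_on k (\<lambda>x. f x + g x) U"
  using assms(2,3)
proof (induction k arbitrary: f g)
  case 0
  then show ?case
    by (simp add: continuous_on_add)
next
  case (Suc k)
  show ?case
    by (rule Ck_on_SucI[OF \<open>open U\<close> has_derivative_add[OF Ck_on_Suc_has_derivative[OF Suc.prems(1)]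
            Ck_on_Suc_has_derivative[OF Suc.prems(2)]] Suc.IH])
      (use Suc.prems in auto)
qed

lemma Ck_on_Pair:
  assumes "open U" "Ck_on k f U" "Ck_on k g U"
  shows "Ck_on k (\<lambda>x. (f x, g x)) U"
  using assms(2,3)
proof (induction k arbitrary: f g)
  case 0
  then show ?case
    by (simp add: continuous_on_Pair)
next
  case (Suc k)
  show ?case
    by (rule Ck_on_SucI[OF \<open>open U\<close> has_derivative_Pair[OF Ck_on_Suc_has_derivative[OF Suc.prems(1)]
            Ck_on_Suc_has_derivative[OF Suc.prems(2)]] Suc.IH])
      (use Suc.prems in auto)
qed

lemma Ck_on_bounded_bilinear:
  assumes "bounded_bilinear prd" "open U" "Ck_on k f U" "Ck_on k g U"
  shows "Ck_on k (\<lambda>x. prd (f x) (g x)) U"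
  using assms(3,4)
proof (induction k arbitrary: f g)
  case 0
  then show ?case
    using bounded_bilinear.continuous_on[OF assms(1)] by simp
next
  case (Suc k)
  show ?case
    by (rule Ck_on_SucI[OF \<open>open U\<close> bounded_bilinear.FDERIV[OF assms(1)
            Ck_on_Suc_has_derivative[OF Suc.prems(1)] Ck_on_Suc_has_derivative[OF Suc.prems(2)]]
            Ck_on_add[OF \<open>open U\<close>]])
      \<comment> \<open>Each summand of the product rule has one factor left undifferentiated, whose
        order must be lowered by one before the induction hypothesis applies.\<close>
      (use Suc.prems Suc.prems[THEN Ck_on_SucD] in \<open>auto intro!: Suc.IH\<close>)
qed

lemmas Ck_on_mult = Ck_on_bounded_bilinear[OF bounded_bilinear_mult]
lemmas Ck_on_scaleR = Ck_on_bounded_bilinear[OF bounded_bilinear_scaleR]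
lemmas Ck_on_inner = Ck_on_bounded_bilinear[OF bounded_bilinear_inner]

text \<open>The family \<phi> is closed under differentiation, so the chain rule yields a product of
  another member composed with \<open>f\<close> and a directional derivative of \<open>f\<close>.
  Hence the induction keeps \<open>n\<close> arbitrary.\<close>

lemma Ck_on_compose_real:
  fixes \<phi> :: "nat \<Rightarrow> real \<Rightarrow> real"
  assumes "\<And>n r. (\<phi> n has_field_derivative \<phi> (Suc n) r) (at r)"
    and "open U" "Ck_on k f U"
  shows "Ck_on k (\<lambda>x. \<phi> n (f x)) U"
  using assms(3)
proof (induction k arbitrary: n)
  case 0
  have "continuous_on UNIV (\<phi> n)"
    using assms(1) by (meson DERIV_isCont continuous_at_imp_continuous_on)
  with 0 show ?case
    by (auto intro: continuous_on_compose2)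
next
  case (Suc k)
  have deriv: "((\<lambda>x. \<phi> n (f x)) has_derivative
      (\<lambda>v. \<phi> (Suc n) (f x) * frechet_derivative f (at x) v)) (at x)" if "x \<in> U" for x
    using has_derivative_compose[OF Ck_on_Suc_has_derivative[OF Suc.prems that]
        assms(1)[unfolded has_field_derivative_def]] by simp
  show ?case
    by (rule Ck_on_SucI[OF \<open>open U\<close> deriv Ck_on_mult])
      (use Suc.prems \<open>open U\<close> Suc.IH Ck_on_SucD[OF Suc.prems] in auto)
qed

lemma Ck_on_sin:
  fixes f :: "'a::euclidean_space \<Rightarrow> real"
  assumes "open U" "Ck_on k f U"
  shows "Ck_on k (\<lambda>x. sin (f x)) U"
proof -
  \<comment> \<open>Differentiating the sine shifts its argument by a quarter period, which makes
    all its derivatives a single indexed family.\<close>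
  have "((\<lambda>r. sin (r + real n * (pi/2))) has_field_derivative sin (r + real (Suc n) * (pi/2))) (at r)"
    for n r
  proof -
    have "r + real (Suc n) * (pi/2) = (r + real n * (pi/2)) + pi/2"
      by (simp add: field_simps)
    then have "sin (r + real (Suc n) * (pi/2)) = cos (r + real n * (pi/2))"
      by (simp only: sin_add[of _ "pi/2"]) simp
    then show ?thesis
      by (auto intro!: derivative_eq_intros)
  qed
  from Ck_on_compose_real[where \<phi> = "\<lambda>n r. sin (r + real n * (pi/2))", OF this assms, of 0]
  show ?thesis by simp
qed

lemma Ck_on_cos:
  fixes f :: "'a::euclidean_space \<Rightarrow> real"
  assumes "open U" "Ck_on k f U"
  shows "Ck_on k (\<lambda>x. cos (f x)) U"
proof -
  have "Ck_on k (\<lambda>x. sin (f x + pi/2)) U"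
    by (intro Ck_on_sin Ck_on_add Ck_on_const assms)
  then show ?thesis
    by (simp add: sin_add)
qed

lemma Ck_on_entire_power_series:
  fixes f :: "'a::euclidean_space \<Rightarrow> real" and c :: "nat \<Rightarrow> real"
  assumes "\<And>r. summable (\<lambda>m. c m * r ^ m)" "open U" "Ck_on k f U"
  shows "Ck_on k (\<lambda>x. \<Sum>m. c m * f x ^ m) U"
proof -
  \<comment> \<open>Formal differentiation of the coefficients preserves convergence everywhere, so
    the iterates of \<open>diffs\<close> supply the required family.\<close>
  have summ: "summable (\<lambda>m. (diffs ^^ n) c m * r ^ m)" for n r
    by (induction n arbitrary: r) (auto intro: assms(1) termdiff_converges_all)
  have "((\<lambda>r. \<Sum>m. (diffs ^^ n) c m * r ^ m) has_field_derivative
      (\<Sum>m. (diffs ^^ Suc n) c m * r ^ m)) (at r)" for n r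
    using termdiffs_strong_converges_everywhere[OF summ] by simp
  from Ck_on_compose_real[where \<phi> = "\<lambda>n r. \<Sum>m. (diffs ^^ n) c m * r ^ m",
      OF this assms(2,3), of 0]
  show ?thesis by simp
qed

lemma smooth_map_on_globalI:
  assumes "\<And>k. Ck_on k g UNIV" "\<And>y. y \<in> A \<Longrightarrow> g y = f y"
  shows "smooth_map_on A f"
  unfolding smooth_map_on_def using assms by (intro ballI exI[of _ UNIV] exI[of _ g]) auto


section \<open>The cardinal sine\<close>

text \<open>This is sin r / r, with value 1 at 0. The sine series has no constant term, so shifting
  its coefficients by one divides it by r.\<close>

definition sinc :: "real \<Rightarrow> real" where
  "sinc r = (\<Sum>n. sin_coeff (Suc n) * r ^ n)"

lemma summable_sinc: "summable (\<lambda>n. sin_coeff (Suc n) * r ^ n)" for r :: real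
proof (cases "r = 0")
  case False
  have "summable (\<lambda>n. sin_coeff (Suc n) * r ^ Suc n)"
    using sums_summable[OF sin_converges[of r]] by (subst summable_Suc_iff) simp
  then have "summable (\<lambda>n. inverse r * (sin_coeff (Suc n) * r ^ Suc n))"
    by (rule summable_mult)
  then show ?thesis
    using False by (simp add: field_simps)
qed simp

lemma mult_sinc: "r * sinc r = sin r"
proof -
  have "(\<lambda>n. sin_coeff (Suc n) * r ^ Suc n) sums sin r"
    using sin_converges[of r] by (subst sums_Suc_iff) (simp add: sin_coeff_def)
  moreover have "(\<lambda>n. r * (sin_coeff (Suc n) * r ^ n)) sums (r * sinc r)"
    unfolding sinc_def by (intro sums_mult summable_sums summable_sinc)
  ultimately show ?thesis
    by (simp add: mult.left_commute sums_unique2)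
qed

lemma Ck_on_sinc: "open U \<Longrightarrow> Ck_on k f U \<Longrightarrow> Ck_on k (\<lambda>x. sinc (f x)) U"
  unfolding sinc_def by (rule Ck_on_entire_power_series[OF summable_sinc])


section \<open>Quaternions\<close>

lemma qcnj_mult: "qcnj (p * q) = qcnj q * qcnj p"
  by (simp add: qcnj_def times_quat_def)

lemma qcnj_qcnj [simp]: "qcnj (qcnj q) = q"
  by (simp add: qcnj_def)

lemma qcnj_one [simp]: "qcnj 1 = 1"
  by (simp add: qcnj_def one_quat_def)

lemma norm_qcnj [simp]: "norm (qcnj q) = norm q"
  by (simp add: qcnj_def norm_quat_def inner_quat_def)

lemma bounded_linear_qcnj: "bounded_linear qcnj"
  by (rule bounded_linear_intro[where K = 1])
    (simp_all del: norm_qcnj add: norm_qcnj[THEN eq_refl], simp_all add: qcnj_def plus_quat_def scaleR_quat_def)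

lemma S3_mult: "p \<in> S3 \<Longrightarrow> q \<in> S3 \<Longrightarrow> p * q \<in> S3"
  by (simp add: S3_def norm_mult)

lemma qcnj_S3: "q \<in> S3 \<Longrightarrow> qcnj q \<in> S3"
  by (simp add: S3_def)

lemma S3_mult_qcnj:
  assumes "q \<in> S3"
  shows "q * qcnj q = 1" "qcnj q * q = 1" "q * (qcnj q * p) = p" "qcnj q * (q * p) = p"
  using assms by (simp_all add: S3_def quat_mult_qcnj flip: mult.assoc)

lemma S3_inverse: "q \<in> S3 \<Longrightarrow> inverse q = qcnj q"
  by (simp add: S3_def inverse_quat_def)

text \<open>Even powers of \<open>u\<close> are 1 up to sign and odd powers are \<open>u\<close> up
  to sign, so the exponential series splits termwise into the cosine and sine series.\<close>

lemma exp_scaleR_imaginary_unit: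
  fixes u :: "'a::{real_normed_algebra_1,banach}"
  assumes "u * u = -1"
  shows "exp (r *\<^sub>R u) = cos r *\<^sub>R 1 + sin r *\<^sub>R u"
proof -
  have even: "u ^ (2 * m) = (-1) ^ m *\<^sub>R 1" for m
    by (induction m) (simp_all add: assms mult.assoc[symmetric])
  have "(r *\<^sub>R u) ^ n /\<^sub>R fact n = (cos_coeff n * r ^ n) *\<^sub>R 1 + (sin_coeff n * r ^ n) *\<^sub>R u" for n
  proof (cases "even n")
    case True
    then obtain m where "n = 2 * m" by blast
    then show ?thesis
      by (simp add: even even[unfolded mult.commute[of 2]] cos_coeff_def sin_coeff_def field_simps)
  next
    case False
    then obtain m where m: "n = Suc (2 * m)" by (auto elim: oddE)
    have "u ^ n = (-1) ^ m *\<^sub>R u"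
      by (simp add: m even)
    then show ?thesis
      by (simp add: m cos_coeff_def sin_coeff_def divide_inverse mult_ac del: power_Suc)
  qed
  moreover have "(\<lambda>n. (cos_coeff n * r ^ n) *\<^sub>R 1 + (sin_coeff n * r ^ n) *\<^sub>R u) sums
      (cos r *\<^sub>R 1 + sin r *\<^sub>R u)"
    by (rule sums_add; rule sums_scaleR_left)
      (use cos_converges[of r] sin_converges[of r] in simp_all)
  ultimately show ?thesis
    using exp_converges[of "r *\<^sub>R u"] by (simp add: sums_unique2)
qed


section \<open>The action and the maps \<open>hat \<theta>\<close>\<close>

lemma act_act: "act p (act q z) = act (p * q) z"
  by (cases z) (simp add: act_def qcnj_mult mult.assoc)

lemma act_one [simp]: "act 1 z = z"
  by (cases z) (simp add: act_def)

lemma act_S7: "q \<in> S3 \<Longrightarrow> z \<in> S7 \<Longrightarrow> act q z \<in> S7"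
  by (cases z) (simp add: act_def S7_def S3_def norm_mult)

lemma equivariant_map_S3: "equivariant_map \<theta> \<Longrightarrow> z \<in> S7 \<Longrightarrow> \<theta> z \<in> S3"
  by (simp add: equivariant_map_def)

lemma equivariant_map_act:
  "equivariant_map \<theta> \<Longrightarrow> q \<in> S3 \<Longrightarrow> z \<in> S7 \<Longrightarrow> \<theta> (act q z) = q * \<theta> z * qcnj q"
  by (simp add: equivariant_map_def S3_inverse)

lemma hat_S7: "equivariant_map \<theta> \<Longrightarrow> z \<in> S7 \<Longrightarrow> hat \<theta> z \<in> S7"
  by (simp add: hat_def act_S7 equivariant_map_S3)

lemma equivariant_map_mult:
  assumes "equivariant_map \<theta>" "equivariant_map \<eta>"
  shows "equivariant_map (\<lambda>z. \<theta> z * \<eta> z)"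
  using assms unfolding equivariant_map_def
  by (auto simp: S3_mult S3_inverse mult.assoc S3_mult_qcnj)

lemma equivariant_map_qcnj:
  assumes "equivariant_map \<theta>"
  shows "equivariant_map (\<lambda>z. qcnj (\<theta> z))"
  using assms unfolding equivariant_map_def
  by (auto simp: qcnj_S3 S3_inverse mult.assoc qcnj_mult)

text \<open>Equivariance at \<open>q = \<theta> z\<close> turns the outer factor into the conjugate
  of \<open>\<eta> z\<close> by \<open>\<theta> z\<close>; multiplied on the right by
  \<open>\<theta> z\<close>, it leaves \<open>\<theta> z * \<eta> z\<close>, in this order.\<close>

lemma hat_comp:
  assumes "equivariant_map \<theta>" "equivariant_map \<eta>" "z \<in> S7"
  shows "hat \<eta> (hat \<theta> z) = hat (\<lambda>z. \<theta> z * \<eta> z) z"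
  using assms equivariant_map_S3[OF assms(1,3)]
  by (simp add: hat_def equivariant_map_act act_act mult.assoc S3_mult_qcnj)

lemma hat_qcnj_inverse:
  assumes "equivariant_map \<theta>" "z \<in> S7"
  shows "hat (\<lambda>z. qcnj (\<theta> z)) (hat \<theta> z) = z" "hat \<theta> (hat (\<lambda>z. qcnj (\<theta> z)) z) = z"
  using assms equivariant_map_qcnj[OF assms(1)] equivariant_map_S3[OF assms]
  by (simp_all add: hat_comp, simp_all add: hat_def S3_mult_qcnj)

lemma bij_betw_hat:
  assumes "equivariant_map \<theta>"
  shows "bij_betw (hat \<theta>) S7 S7"
  by (rule bij_betw_byWitness[where f' = "hat (\<lambda>z. qcnj (\<theta> z))"])
    (use assms equivariant_map_qcnj[OF assms] in \<open>auto simp: hat_qcnj_inverse hat_S7\<close>)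

lemma inv_into_hat:
  assumes "equivariant_map \<theta>" "z \<in> S7"
  shows "inv_into S7 (hat \<theta>) z = hat (\<lambda>z. qcnj (\<theta> z)) z"
  by (rule inv_into_f_eq)
    (use assms equivariant_map_qcnj[OF assms(1)] bij_betw_hat[OF assms(1)]
      in \<open>auto simp: hat_qcnj_inverse hat_S7 bij_betw_def\<close>)

lemma Ck_on_act:
  assumes "open U" "Ck_on k f U" "Ck_on k g U"
  shows "Ck_on k (\<lambda>x. act (f x) (g x)) U"
  unfolding act_def case_prod_beta
  by (intro Ck_on_Pair Ck_on_mult Ck_on_bounded_linear[OF bounded_linear_fst]
      Ck_on_bounded_linear[OF bounded_linear_snd] Ck_on_bounded_linear[OF bounded_linear_qcnj] assms)

text \<open>Smoothness is asked of an ambient extension \<Theta>, since the formula for \<theta>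
  need not be smooth off the sphere. Conjugating \<Theta> gives the extension needed for the
  inverse.\<close>

lemma diffeomorphism_on_hat:
  assumes "equivariant_map \<theta>" "\<And>k. Ck_on k \<Theta> UNIV" "\<And>z. z \<in> S7 \<Longrightarrow> \<Theta> z = \<theta> z"
  shows "diffeomorphism_on S7 (hat \<theta>)"
  unfolding diffeomorphism_on_def
proof (intro conjI)
  show "smooth_map_on S7 (hat \<theta>)"
    by (rule smooth_map_on_globalI[where g = "\<lambda>z. act (\<Theta> z) z"])
      (use assms in \<open>auto simp: hat_def intro!: Ck_on_act Ck_on_ident\<close>)
  show "smooth_map_on S7 (inv_into S7 (hat \<theta>))"
    by (rule smooth_map_on_globalI[where g = "\<lambda>z. act (qcnj (\<Theta> z)) z"])
      (use assms in \<open>auto simp: inv_into_hat hat_def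
          intro!: Ck_on_act Ck_on_ident Ck_on_bounded_linear[OF bounded_linear_qcnj]\<close>)
qed (rule bij_betw_hat[OF assms(1)])

lemma diffeomorphism_on_cong:
  assumes "\<And>z. z \<in> M \<Longrightarrow> f z = g z"
  shows "diffeomorphism_on M f \<longleftrightarrow> diffeomorphism_on M g"
proof -
  have "bij_betw f M M \<longleftrightarrow> bij_betw g M M"
    using assms by (rule bij_betw_cong)
  moreover have "smooth_map_on M f \<longleftrightarrow> smooth_map_on M g"
    using assms unfolding smooth_map_on_def by (metis IntD2)
  \<comment> \<open>The choice behind \<open>inv_into\<close> ranges over points of \<open>M\<close>
    only, so the two inverses agree at every argument.\<close>
  moreover have "inv_into M f = inv_into M g"
    unfolding inv_into_def by (intro ext arg_cong[where f = Eps]) (auto simp: assms)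
  ultimately show ?thesis
    by (simp add: diffeomorphism_on_def)
qed


section \<open>The maps \<open>\<theta>\<^sub>8\<^sub>,\<^sub>t\<close>\<close>

lemma alpha_mult_alpha: "alpha t * alpha t = -1"
proof -
  have "alpha t * alpha t = (- ((sin t)\<^sup>2 + (cos t)\<^sup>2)) *\<^sub>R 1"
    by (simp add: alpha_def quat_i_def quat_j_def quat_ring_defs scaleR_quat_def power2_eq_square
        del: sin_cos_squared_add)
  then show ?thesis by simp
qed

lemma alpha_add_pi: "alpha (t + pi) = - alpha t"
  by (simp add: alpha_def)

lemma alpha_pi: "alpha pi = - alpha 0"
  using alpha_add_pi[of 0] by simp

lemma qcnj_alpha: "qcnj (alpha t) = - alpha t"
  by (simp add: alpha_def qcnj_def quat_i_def quat_j_def quat_ring_defs scaleR_quat_def)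

text \<open>The element \<open>x * alpha t * qcnj x\<close> squares to minus the fourth power of
  \<open>norm x\<close>, so dividing by the squared norm gives an imaginary unit. Writing the result
  with \<open>sinc\<close> also covers \<open>x = 0\<close>.\<close>

lemma exp_conj_alpha:
  "exp (pi *\<^sub>R (x * alpha t * qcnj x)) =
    cos (pi * (norm x)\<^sup>2) *\<^sub>R 1 + (pi * sinc (pi * (norm x)\<^sup>2)) *\<^sub>R (x * alpha t * qcnj x)"
proof (cases "x = 0")
  case False
  define s where "s = (norm x)\<^sup>2"
  define u where "u = (1 / s) *\<^sub>R (x * alpha t * qcnj x)"
  have s: "s \<noteq> 0"
    using False by (simp add: s_def)
  have "x * alpha t * qcnj x * (x * alpha t * qcnj x) = x * alpha t * (qcnj x * x) * alpha t * qcnj x"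
    by (simp add: mult.assoc)
  also have "\<dots> = s *\<^sub>R (x * (alpha t * alpha t) * qcnj x)"
    by (simp add: quat_mult_qcnj s_def mult.assoc)
  also have "\<dots> = - (s\<^sup>2 *\<^sub>R 1)"
    by (simp add: alpha_mult_alpha quat_mult_qcnj s_def power2_eq_square)
  finally have "u * u = -1"
    using s by (simp add: u_def power2_eq_square)
  moreover have "pi *\<^sub>R (x * alpha t * qcnj x) = (pi * s) *\<^sub>R u"
    using s by (simp add: u_def)
  moreover have "sin (pi * s) *\<^sub>R u = (pi * sinc (pi * s)) *\<^sub>R (x * alpha t * qcnj x)"
    using s by (simp add: u_def flip: mult_sinc)
  ultimately show ?thesis
    by (simp add: exp_scaleR_imaginary_unit s_def)
qed simp

text \<open>The exponent is purely imaginary, so conjugating the exponential inverts it. In the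
  closed formula, conjugation amounts to replacing \<open>t\<close> by
  \<open>t + pi\<close>.\<close>

lemma norm_exp_conj_alpha: "norm (exp (pi *\<^sub>R (x * alpha t * qcnj x))) = 1"
proof -
  let ?y = "pi *\<^sub>R (x * alpha t * qcnj x)"
  have "qcnj (exp ?y) = exp (pi *\<^sub>R (x * alpha (t + pi) * qcnj x))"
    unfolding exp_conj_alpha
    by (simp add: linear_add linear_scale bounded_linear.linear[OF bounded_linear_qcnj]
        qcnj_mult qcnj_alpha alpha_add_pi mult.assoc)
  also have "\<dots> = exp (- ?y)"
    by (simp add: alpha_add_pi)
  finally have "qcnj (exp ?y) = exp (- ?y)" .
  then have "exp ?y * qcnj (exp ?y) = 1"
    by (simp add: exp_minus_inverse)
  then have "(norm (exp ?y))\<^sup>2 *\<^sub>R (1::quat) = 1"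
    by (simp add: quat_mult_qcnj)
  then have "norm ((norm (exp ?y))\<^sup>2 *\<^sub>R (1::quat)) = 1"
    by simp
  then show ?thesis
    by (intro power2_eq_imp_eq[of _ 1]) simp_all
qed

text \<open>Here \<open>pi * sinc (pi * a)\<close> is sin (pi a) / a, so the coefficient is the
  partial fraction form of \<open>c\<close>. Inner products replace norms because they are smooth at
  0 too.\<close>

definition smooth_theta :: "real \<Rightarrow> quat \<times> quat \<Rightarrow> quat" where
  "smooth_theta t = (\<lambda>(x, w). cos (pi * (x \<bullet> x)) *\<^sub>R 1 +
     (pi * sinc (pi * (x \<bullet> x)) + pi * sinc (pi * (w \<bullet> w))) *\<^sub>R
       (w * (x * alpha t * qcnj x) * qcnj w))"

lemma theta8t_eq_smooth_theta:
  assumes "z \<in> S7"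
  shows "theta8t t z = smooth_theta t z"
proof -
  obtain x w where z: "z = (x, w)"
    by (cases z)
  define a b where "a = x \<bullet> x" and "b = w \<bullet> w"
  have ab: "a + b = 1"
    using assms by (simp add: z S7_def a_def b_def power2_norm_eq_inner)
  show ?thesis
  proof (cases "w = 0")
    case True
    \<comment> \<open>Now \<open>a = 1\<close>, so the cosine is -1, the default value in
      \<open>theta8t\<close>, and the other summand vanishes with \<open>w\<close>.\<close>
    then show ?thesis
      using ab by (simp add: z theta8t_def smooth_theta_def b_def flip: a_def)
  next
    case False
    then have b: "b \<noteq> 0"
      by (simp add: b_def)
    have "sin (pi * b) = sin (pi * a)"
    proof -
      have "pi * b = pi - pi * a"
        using ab by (simp add: algebra_simps flip: distrib_left)
      then show ?thesis by simp
    qed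
    then have ba: "(pi * b) * sinc (pi * b) = (pi * a) * sinc (pi * a)"
      by (simp add: mult_sinc)
    \<comment> \<open>The two sine values agree because \<open>b = 1 - a\<close>; this merges the
      partial fractions back into a single one.\<close>
    have "b * (pi * sinc (pi * a) + pi * sinc (pi * b)) = (a + b) * (pi * sinc (pi * a))"
      using ba by (simp add: algebra_simps)
    then have coeff: "pi * sinc (pi * a) + pi * sinc (pi * b) = pi * sinc (pi * a) / b"
      using ab b by (simp add: field_simps)
    have nw: "norm w * norm w = b" "w * qcnj w = b *\<^sub>R 1"
      by (simp_all add: b_def quat_mult_qcnj power2_norm_eq_inner flip: power2_eq_square)
    have "theta8t t z = (1 / b) *\<^sub>R (w * (cos (pi * a) *\<^sub>R 1 +
        (pi * sinc (pi * a)) *\<^sub>R (x * alpha t * qcnj x)) * qcnj w)"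
      using False by (simp add: z theta8t_def exp_conj_alpha power2_norm_eq_inner a_def nw(1)[symmetric]
          divide_inverse)
    also have "\<dots> = smooth_theta t z"
      using b by (simp add: z smooth_theta_def a_def[symmetric] b_def[symmetric] coeff
          distrib_left distrib_right nw scaleR_add_right)
    finally show ?thesis .
  qed
qed

text \<open>The action preserves both norms, and in
  \<open>w * (x * alpha t * qcnj x) * qcnj w\<close> the inner factors \<open>qcnj q * q\<close>
  cancel, leaving a conjugation by \<open>q\<close>.\<close>

lemma smooth_theta_act:
  assumes "q \<in> S3"
  shows "smooth_theta t (act q z) = q * smooth_theta t z * qcnj q"
proof -
  obtain x w where z: "z = (x, w)"
    by (cases z)
  have *: "(q * x) \<bullet> (q * x) = x \<bullet> x" "(q * w * qcnj q) \<bullet> (q * w * qcnj q) = w \<bullet> w"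
    using assms by (simp_all add: S3_def norm_mult flip: power2_norm_eq_inner)
  show ?thesis
    unfolding z act_def smooth_theta_def case_prod_conv *
    using assms by (simp add: qcnj_mult mult.assoc S3_mult_qcnj distrib_left distrib_right)
qed

text \<open>Unit length is read off the exponential formula, equivariance off the smooth
  one.\<close>

lemma equivariant_map_theta8t: "equivariant_map (theta8t t)"
  unfolding equivariant_map_def
proof (intro conjI ballI)
  show "theta8t t z \<in> S3" for z
    by (cases z) (simp add: theta8t_def S3_def norm_mult norm_exp_conj_alpha divide_simps)
  show "theta8t t (act q z) = q * theta8t t z * inverse q" if "q \<in> S3" "z \<in> S7" for q z
    using that by (simp add: theta8t_eq_smooth_theta act_S7 smooth_theta_act S3_inverse)
qed

text \<open>Since \<open>alpha pi = - alpha 0\<close>, the two exponents are opposite; where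
  \<open>w = 0\<close> both factors are -1.\<close>

lemma theta8_mult_theta8t_pi: "theta8 z * theta8t pi z = 1"
proof -
  obtain x w where z: "z = (x, w)"
    by (cases z)
  show ?thesis
  proof (cases "w = 0")
    case True
    then show ?thesis
      by (simp add: z theta8_def theta8t_def)
  next
    case False
    define v where "v = w /\<^sub>R norm w"
    define y where "y = pi *\<^sub>R (x * alpha 0 * qcnj x)"
    have v: "v \<in> S3" and qv: "qcnj w /\<^sub>R norm w = qcnj v"
      using False by (simp_all add: v_def S3_def linear_scale[OF bounded_linear.linear[OF bounded_linear_qcnj]])
    have "theta8 z * theta8t pi z = v * exp y * qcnj v * (v * exp (- y) * qcnj v)"
      using False by (simp add: z theta8_def theta8t_def alpha_pi y_def flip: v_def qv)
    also have "\<dots> = v * (exp y * exp (- y)) * qcnj v"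
      using v by (simp add: mult.assoc S3_mult_qcnj)
    also have "\<dots> = 1"
      using v by (simp add: exp_minus_inverse S3_mult_qcnj)
    finally show ?thesis .
  qed
qed

lemma Ck_on_smooth_theta:
  assumes "open U" "Ck_on k T U" "Ck_on k Z U"
  shows "Ck_on k (\<lambda>p. smooth_theta (T p) (Z p)) U"
  unfolding smooth_theta_def alpha_def case_prod_beta
  by (intro Ck_on_add Ck_on_mult Ck_on_scaleR Ck_on_inner Ck_on_sin Ck_on_cos Ck_on_sinc
      Ck_on_const Ck_on_bounded_linear[OF bounded_linear_fst]
      Ck_on_bounded_linear[OF bounded_linear_snd] Ck_on_bounded_linear[OF bounded_linear_qcnj] assms)

theorem mainTheorem5:
  shows "(\<forall>t\<in>{0..pi}. equivariant_map (theta8t t) \<and>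
            equivariant_map (\<lambda>z. theta8 z * theta8t t z)) \<and>
         (\<forall>t\<in>{0..pi}. \<forall>z\<in>S7.
            (hat (theta8t t) \<circ> hat theta8) z = hat (\<lambda>z. theta8 z * theta8t t z) z) \<and>
         isotopy_of_diffeos 0 pi S7 (\<lambda>t. hat (theta8t t) \<circ> hat theta8)
           (hat theta8 \<circ> hat theta8) id"
proof -
  have eq8: "equivariant_map theta8"
    by (simp add: theta8_def equivariant_map_theta8t)
  have eqprod: "equivariant_map (\<lambda>z. theta8 z * theta8t t z)" for t
    by (intro equivariant_map_mult eq8 equivariant_map_theta8t)
  have comp: "(hat (theta8t t) \<circ> hat theta8) z = hat (\<lambda>z. theta8 z * theta8t t z) z"
    if "z \<in> S7" for t z
    using hat_comp[OF eq8 equivariant_map_theta8t that] by simp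
  have ext: "smooth_theta 0 z * smooth_theta t z = theta8 z * theta8t t z" if "z \<in> S7" for t z
    using that by (simp add: theta8_def theta8t_eq_smooth_theta)
  have "isotopy_of_diffeos 0 pi S7 (\<lambda>t. hat (theta8t t) \<circ> hat theta8)
      (hat theta8 \<circ> hat theta8) id"
    unfolding isotopy_of_diffeos_def
  proof (intro conjI ballI)
    show "smooth_map_on ({0..pi} \<times> S7) (\<lambda>(t, z). (hat (theta8t t) \<circ> hat theta8) z)"
    proof (rule smooth_map_on_globalI)
      \<comment> \<open>One extension in \<open>p = (t, z)\<close> gives smoothness jointly in time
        and position.\<close>
      show "Ck_on k (\<lambda>p. act (smooth_theta 0 (snd p) * smooth_theta (fst p) (snd p)) (snd p)) UNIV" for k
        by (intro Ck_on_act Ck_on_mult Ck_on_smooth_theta Ck_on_const open_UNIV Ck_on_ident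
            Ck_on_bounded_linear[OF bounded_linear_fst] Ck_on_bounded_linear[OF bounded_linear_snd])
    qed (auto simp: comp[simplified] ext hat_def[of "\<lambda>z. _ z * _ z"])
    show "diffeomorphism_on S7 (hat (theta8t t) \<circ> hat theta8)" for t
    proof -
      have "diffeomorphism_on S7 (hat (theta8t t) \<circ> hat theta8) \<longleftrightarrow>
          diffeomorphism_on S7 (hat (\<lambda>z. theta8 z * theta8t t z))"
        by (rule diffeomorphism_on_cong) (rule comp)
      moreover have "diffeomorphism_on S7 (hat (\<lambda>z. theta8 z * theta8t t z))"
        by (rule diffeomorphism_on_hat[OF eqprod _ ext])
          (intro Ck_on_mult Ck_on_smooth_theta Ck_on_const open_UNIV Ck_on_ident)
      ultimately show ?thesis
        by simp
    qed
    show "(hat (theta8t 0) \<circ> hat theta8) z = (hat theta8 \<circ> hat theta8) z" for z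
      by (simp add: theta8_def)
    show "(hat (theta8t pi) \<circ> hat theta8) z = id z" if "z \<in> S7" for z
      unfolding comp[OF that] by (simp add: hat_def theta8_mult_theta8t_pi)
  qed
  with eqprod comp show ?thesis
    by (simp add: equivariant_map_theta8t)
qed

end
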